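(* The $P_{-3}$ set $\{3,4,13\}$ cannot be extended; that is, there is no positive integer $m\notin\{3,4,13\}$ such that $\{3,4,13,m\}$ is a $P_{-3}$ set.
   Context: Let $n$ be an integer. A set $\{a_1,\dots,a_r\}$ of $r$ distinct positive integers has the property $D(n)$, and is called a $P_n$ set of size $r$ (or a Diophantine $r$-tuple with the property $D(n)$), if $a_ia_j+n$ is a perfect square (the square of an integer) for all $1\le i<j\le r$. A $P_n$ set of size 3 cannot be extended (is non-extendable) if it cannot be enlarged to a $P_n$ set of size 4 (a Diophantine quadruple with the property $D(n)$) by adjoining a further positive integer distinct from its elements. *)

theory Defs
  imports Main "HOL-Computational_Algebra.Nth_Powers"
begin

text \<open>
  \<open>P_set n r A\<close>: the set \<open>A\<close> is a \<open>P\<^sub>n\<close> set of size \<open>r\<close>, i.e. a Diophantine \<open>r\<close>-tuple with the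
  property \<open>D(n)\<close>. Ranging over pairs of distinct elements of \<open>A\<close> replaces the indices \<open>i < j\<close>.
  As \<open>a * b + n\<close> may be negative, everything lives in \<^typ>\<open>int\<close>; \<open>0\<close> counts as a square.
\<close>
definition P_set :: "int \<Rightarrow> nat \<Rightarrow> int set \<Rightarrow> bool" where
  "P_set n r A \<longleftrightarrow> finite A \<and> card A = r \<and> (\<forall>a\<in>A. a > 0) \<and>
     (\<forall>a\<in>A. \<forall>b\<in>A. a \<noteq> b \<longrightarrow> is_square (a * b + n))"

end

theory Submission imports Defs begin

text \<open>
  Already the residues of \<open>m\<close> modulo \<open>4\<close> obstruct an extension. An odd square is \<open>1\<close> modulo \<open>8\<close>,
  so if \<open>4m - 3\<close> is a square then \<open>m\<close> is odd. Then \<open>3m - 3\<close> is even, and if it is a square it is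
  divisible by \<open>4\<close>, whence \<open>m \<equiv> 1\<close> modulo \<open>4\<close>. But then \<open>13m - 3 \<equiv> 2\<close> modulo \<open>4\<close>, which is not a
  quadratic residue.
\<close>

lemma odd_square_mod_8:
  fixes y :: int
  assumes "odd y"
  shows "y\<^sup>2 mod 8 = 1"
proof -
  from assms obtain k where k: "y = 2 * k + 1" by (rule oddE)
  have "even (k * (k + 1))" by simp
  then obtain j where j: "k * (k + 1) = 2 * j" by (rule evenE)
  have "y\<^sup>2 = 4 * (k * (k + 1)) + 1"
    by (simp add: k power2_eq_square algebra_simps)
  also have "\<dots> = 8 * j + 1" by (simp add: j)
  finally show ?thesis by simp
qed

lemma even_square_mod_4:
  fixes x :: int
  assumes "even (x\<^sup>2)"
  shows "x\<^sup>2 mod 4 = 0"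
proof -
  from assms have "even x" by simp
  then obtain k where "x = 2 * k" by (rule evenE)
  then show ?thesis by (simp add: power2_eq_square)
qed

lemma not_all_squares_3_4_13:
  fixes m :: int
  assumes "is_square (3 * m - 3)" and "is_square (4 * m - 3)"
  shows "\<not> is_square (13 * m - 3)"
proof
  assume "is_square (13 * m - 3)"
  with assms obtain x y z where
    x: "3 * m - 3 = x\<^sup>2" and y: "4 * m - 3 = y\<^sup>2" and z: "13 * m - 3 = z\<^sup>2"
    by (auto elim!: is_nth_powerE)
  have "odd (4 * m - 3)" by simp
  then have "odd y" using y by simp
  then have "(4 * m - 3) mod 8 = 1" using y odd_square_mod_8 by simp
  then have "odd m" by presburger
  then have "even (x\<^sup>2)" unfolding x[symmetric] by simp
  then have "(3 * m - 3) mod 4 = 0" using x even_square_mod_4 by simp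
  then have m: "(13 * m - 3) mod 4 = 2" by presburger
  then have "even (13 * m - 3)" by presburger
  then have "even (z\<^sup>2)" using z by simp
  then show False using m z even_square_mod_4 by simp
qed

theorem theorem5:
  "P_set (-3) 3 {3, 4, 13} \<and>
   \<not> (\<exists>m::int. m > 0 \<and> m \<notin> {3, 4, 13} \<and> P_set (-3) 4 {3, 4, 13, m})"
proof
  have "is_square (9::int)" "is_square (36::int)" "is_square (49::int)"
    using is_nth_power_nth_power[of 2 "3::int"] is_nth_power_nth_power[of 2 "6::int"]
      is_nth_power_nth_power[of 2 "7::int"] by simp_all
  then show "P_set (-3) 3 {3, 4, 13}" by (simp add: P_set_def)
next
  show "\<not> (\<exists>m::int. m > 0 \<and> m \<notin> {3, 4, 13} \<and> P_set (-3) 4 {3, 4, 13, m})"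
  proof
    assume "\<exists>m::int. m > 0 \<and> m \<notin> {3, 4, 13} \<and> P_set (-3) 4 {3, 4, 13, m}"
    then obtain m :: int where "m \<notin> {3, 4, 13}" and "P_set (-3) 4 {3, 4, 13, m}" by blast
    then have "is_square (3 * m - 3)" "is_square (4 * m - 3)" "is_square (13 * m - 3)"
      by (auto simp: P_set_def)
    then show False using not_all_squares_3_4_13 by blast
  qed
qed

end
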